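(* Let $x,y\in\mathbb{Q}^8$. Then there exists a finite set $S_{xy}\subseteq\mathbb{Q}^8$ containing $x$ and $y$ such that each map $f:S_{xy}\to\mathbb{R}^8$ preserving unit distance preserves the distance between $x$ and $y$, i.e. satisfies $|f(x)-f(y)|=|x-y|$.
   Context: $|\cdot|$ denotes the Euclidean norm on $\mathbb{R}^8$, and $\mathbb{Q}^8\subseteq\mathbb{R}^8$ carries the induced distance. A map $f:S\to\mathbb{R}^8$ with $S\subseteq\mathbb{R}^8$ preserves unit distance if for all $a,b\in S$, $|a-b|=1$ implies $|f(a)-f(b)|=1$ (no continuity, injectivity or other assumption is made on $f$). *)

theory Defs
  imports "HOL-Analysis.Analysis"
begin

definition rational_points :: "(real ^ 'n) set" where
  "rational_points = {x. \<forall>i. x $ i \<in> \<rat>}"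

text \<open>
  A map defined only on \<open>S\<close> is represented by a total function of which only the values on
  \<open>S\<close> are constrained.
\<close>

definition preserves_unit_distance_on ::
    "'a::real_normed_vector set \<Rightarrow> ('a \<Rightarrow> 'b::real_normed_vector) \<Rightarrow> bool" where
  "preserves_unit_distance_on S f \<longleftrightarrow>
     (\<forall>a\<in>S. \<forall>b\<in>S. norm (a - b) = 1 \<longrightarrow> norm (f a - f b) = 1)"

end

theory Submission
  imports Defs "HOL-Computational_Algebra.Primes"
begin

text \<open>
  Call a number \<open>d\<close> rigid if every two rational points at distance \<open>d\<close> lie in a finite rational set
  on which unit preserving maps keep their distance; the goal is that every distance between two
  rational points is rigid. Two facts make this manageable. A reflection in the hyperplane
  orthogonal to a rational vector maps rational points to rational points, so the rational
  isometries move any rational pair to any other rational pair at the same distance, and it suffices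
  to treat one pair for each distance (\<open>rigid_pair_transport\<close>). And finite configurations can be
  chained: once some distances are known to be rigid, a further one is rigid as soon as it is forced
  by them in some finite rational configuration (\<open>rigid_distanceI\<close>).

  The dimension enters through unit simplices. In \<open>\<real>\<^sup>n\<close> two points at unit distance from
  the \<open>n\<close> vertices of a unit facet either coincide or are mirror images of each other, at distance
  \<open>sqrt (2 + 2 / n)\<close> (\<open>two_apexes\<close>, \<open>mirror_apex_distance\<close>). For \<open>n = 8\<close> this is \<open>3 / 2\<close>,
  and moreover \<open>\<rat>\<^sup>8\<close> contains a unit simplex with nine vertices. So the image of a pair at
  distance \<open>3 / 2\<close> is a point or again such a pair, and a triangle with sides
  \<open>3 / 2, 3 / 2, 1\<close> excludes the point (\<open>three_halves_rigid\<close>). From then on every map in question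
  commutes with the operation of mirroring an apex. The mirror image is an affine combination of the
  vertices in which a facet vertex has weight \<open>1 / 4\<close>; mirroring the same vertex in two simplices
  that differ only by an apex and its mirror image therefore yields two points at distance
  \<open>(1 / 4) * (3 / 2) = 3 / 8\<close> (\<open>three_eighths_rigid\<close>).

  The rest is elementary. Four collinear steps of length \<open>3 / 8\<close> span the rigid length \<open>3 / 2\<close>,
  so equality in the triangle inequality makes \<open>3 / 4\<close> rigid, and then all multiples of
  \<open>3 / 8\<close> (\<open>multiples_rigid\<close>). An isosceles triangle whose two legs are divided into \<open>k\<close> equal
  parts shows that a distance is rigid if its \<open>k\<close>-fold is (\<open>division_rigid\<close>), and the altitude of
  an isosceles triangle with legs \<open>(3 / 8) (n + 1)\<close> and base \<open>(3 / 4) (n - 1)\<close> has length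
  \<open>(3 / 4) sqrt n\<close> (\<open>square_roots_rigid\<close>). The square of a distance between rational points is
  rational, so some integer multiple of the distance has that form.

  To realise these triangles by rational points one needs, orthogonally to a given rational vector,
  rational vectors of any prescribed rational squared length. They exist because every nonnegative
  rational is a sum of four rational squares and \<open>8 = 4 + 4\<close>: a rational isometry moves the given
  vector into the first four coordinates and leaves the last four free
  (\<open>rational_perpendicular_exists\<close>).
\<close>

section \<open>Sums of four rational squares\<close>

lemma inj_on_square_mod_prime:
  fixes p :: int
  assumes "prime p" and "2 * h < p"
  shows "inj_on (\<lambda>x. x\<^sup>2 mod p) {0..h}"
proof (rule inj_onI)
  fix x y assume xy: "x \<in> {0..h}" "y \<in> {0..h}" and eq: "x\<^sup>2 mod p = y\<^sup>2 mod p"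
  have "p dvd x\<^sup>2 - y\<^sup>2" using eq by (simp add: mod_eq_dvd_iff)
  also have "x\<^sup>2 - y\<^sup>2 = (x - y) * (x + y)" by (simp add: power2_eq_square algebra_simps)
  finally have "p dvd x - y \<or> p dvd x + y" using assms(1) by (simp add: prime_dvd_mult_iff)
  then show "x = y"
  proof
    assume "p dvd x - y"
    moreover have "\<bar>x - y\<bar> < p" using xy assms(2) by auto
    ultimately show ?thesis using dvd_imp_le_int[of "x - y" p] prime_gt_0_int[OF assms(1)] by auto
  next
    assume "p dvd x + y"
    moreover have "\<bar>x + y\<bar> < p" using xy assms(2) by auto
    ultimately have "x + y = 0" using dvd_imp_le_int[of "x + y" p] prime_gt_0_int[OF assms(1)] by auto
    then show ?thesis using xy by auto
  qed
qed

text \<open>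
  For odd \<open>p\<close>, the \<open>(p + 1) / 2\<close> squares and the \<open>(p + 1) / 2\<close> values of \<open>- 1 - x\<^sup>2\<close> cannot all be distinct
  modulo \<open>p\<close>. Representatives of absolute value below \<open>p / 2\<close> keep the cofactor \<open>m\<close> smaller
  than \<open>p\<close>, which is what the induction over \<open>p\<close> in the four square theorem below consumes.
\<close>

lemma prime_multiple_two_squares_plus_one:
  fixes p :: int
  assumes "prime p"
  obtains a b m where "a\<^sup>2 + b\<^sup>2 + 1 = p * m" "0 < m" "m < p"
proof (cases "p = 2")
  case True
  then show ?thesis using that[of 1 0 1] by simp
next
  case False
  have p2: "p > 2" using False prime_ge_2_int[OF assms] by simp
  then have "odd p" using assms prime_odd_int by blast
  then obtain h where h: "p = 2 * h + 1" by (elim oddE)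
  have h0: "h \<ge> 1" using h p2 by simp
  let ?f = "\<lambda>x::int. x\<^sup>2 mod p" and ?g = "\<lambda>x::int. (- 1 - x\<^sup>2) mod p"
  have injf: "inj_on ?f {0..h}" using inj_on_square_mod_prime[OF assms, of h] h by simp
  have injg: "inj_on ?g {0..h}"
  proof (rule inj_onI)
    fix x y assume xy: "x \<in> {0..h}" "y \<in> {0..h}" "?g x = ?g y"
    then have "p dvd (- 1 - x\<^sup>2) - (- 1 - y\<^sup>2)" by (simp only: mod_eq_dvd_iff)
    then have "p dvd y\<^sup>2 - x\<^sup>2" by simp
    then have "?f y = ?f x" by (simp add: mod_eq_dvd_iff)
    then show "x = y" using inj_onD[OF injf] xy by metis
  qed
  have "?f ` {0..h} \<inter> ?g ` {0..h} \<noteq> {}"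
  proof
    assume dis: "?f ` {0..h} \<inter> ?g ` {0..h} = {}"
    have "card (?f ` {0..h} \<union> ?g ` {0..h}) = card (?f ` {0..h}) + card (?g ` {0..h})"
      using dis by (intro card_Un_disjoint) auto
    also have "\<dots> = 2 * nat (h + 1)" using injf injg by (simp add: card_image)
    finally have "card (?f ` {0..h} \<union> ?g ` {0..h}) = 2 * nat (h + 1)" .
    moreover have "?f ` {0..h} \<union> ?g ` {0..h} \<subseteq> {0..<p}" using p2 by auto
    then have "card (?f ` {0..h} \<union> ?g ` {0..h}) \<le> card {0..<p}" by (intro card_mono) auto
    ultimately show False using h h0 by simp
  qed
  then obtain a b where ab: "a \<in> {0..h}" "b \<in> {0..h}" "?f a = ?g b" by blast
  then have "p dvd a\<^sup>2 - (- 1 - b\<^sup>2)" by (simp only: mod_eq_dvd_iff)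
  then obtain m where m: "a\<^sup>2 + b\<^sup>2 + 1 = p * m" by (auto simp: dvd_def algebra_simps)
  have "a\<^sup>2 \<le> h\<^sup>2" "b\<^sup>2 \<le> h\<^sup>2" using ab by (auto intro: power_mono)
  then have "p * m \<le> 2 * h\<^sup>2 + 1" using m by simp
  also have "\<dots> < p * p"
  proof -
    have "0 < h * (2 * h + 4)" using h0 by simp
    then show ?thesis unfolding h by (simp add: power2_eq_square algebra_simps)
  qed
  finally have "m < p" using p2 by simp
  moreover have "p * m > 0" using m by (smt (verit) zero_le_power2)
  then have "m > 0" using p2 by (simp add: zero_less_mult_iff)
  ultimately show ?thesis using that m by blast
qed

definition four_square_sums :: "real set" where
  "four_square_sums = {a\<^sup>2 + b\<^sup>2 + c\<^sup>2 + d\<^sup>2 | a b c d. a \<in> \<rat> \<and> b \<in> \<rat> \<and> c \<in> \<rat> \<and> d \<in> \<rat>}"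

lemma four_square_sumsI:
  assumes "r = a\<^sup>2 + b\<^sup>2 + c\<^sup>2 + d\<^sup>2" "a \<in> \<rat>" "b \<in> \<rat>" "c \<in> \<rat>" "d \<in> \<rat>"
  shows "r \<in> four_square_sums"
  using assms unfolding four_square_sums_def by blast

lemma four_square_sumsE:
  assumes "r \<in> four_square_sums"
  obtains a b c d where "r = a\<^sup>2 + b\<^sup>2 + c\<^sup>2 + d\<^sup>2" "a \<in> \<rat>" "b \<in> \<rat>" "c \<in> \<rat>" "d \<in> \<rat>"
  using assms unfolding four_square_sums_def by blast

lemma four_square_sums_mult:
  assumes "r \<in> four_square_sums" "s \<in> four_square_sums"
  shows "r * s \<in> four_square_sums"
proof -
  obtain a b c d where r: "r = a\<^sup>2 + b\<^sup>2 + c\<^sup>2 + d\<^sup>2" "a \<in> \<rat>" "b \<in> \<rat>" "c \<in> \<rat>" "d \<in> \<rat>"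
    using assms(1) by (rule four_square_sumsE)
  obtain e f g h where s: "s = e\<^sup>2 + f\<^sup>2 + g\<^sup>2 + h\<^sup>2" "e \<in> \<rat>" "f \<in> \<rat>" "g \<in> \<rat>" "h \<in> \<rat>"
    using assms(2) by (rule four_square_sumsE)
  show ?thesis
  proof (rule four_square_sumsI)
    \<comment> \<open>Euler's identity: the norm of a product of quaternions.\<close>
    show "r * s = (a*e - b*f - c*g - d*h)\<^sup>2 + (a*f + b*e + c*h - d*g)\<^sup>2
        + (a*g - b*h + c*e + d*f)\<^sup>2 + (a*h + b*g - c*f + d*e)\<^sup>2"
      unfolding r s by (simp add: power2_eq_square algebra_simps)
  qed (use r s in auto)
qed

lemma four_square_sums_inverse:
  assumes "r \<in> four_square_sums"
  shows "inverse r \<in> four_square_sums"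
proof -
  obtain a b c d where r: "r = a\<^sup>2 + b\<^sup>2 + c\<^sup>2 + d\<^sup>2" "a \<in> \<rat>" "b \<in> \<rat>" "c \<in> \<rat>" "d \<in> \<rat>"
    using assms(1) by (rule four_square_sumsE)
  have rat: "r \<in> \<rat>" using r by simp
  have "inverse r = r / r\<^sup>2" by (simp add: power2_eq_square field_simps)
  also have "\<dots> = (a/r)\<^sup>2 + (b/r)\<^sup>2 + (c/r)\<^sup>2 + (d/r)\<^sup>2"
    by (subst (1) r(1)) (simp add: power_divide add_divide_distrib)
  finally show ?thesis by (rule four_square_sumsI) (use r rat in auto)
qed

text \<open>
  With rational instead of integer squares the set of four square sums is closed under inverses, so
  no descent is needed: a prime is the quotient of \<open>a\<^sup>2 + b\<^sup>2 + 1\<close> by a smaller number.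
\<close>

lemma of_nat_in_four_square_sums: "real n \<in> four_square_sums"
proof (induction n rule: less_induct)
  case (less n)
  consider "n = 0" | "n = 1" | "prime n" | "n > 1" "\<not> prime n" by linarith
  then show ?case
  proof cases
    case 1
    then show ?thesis by (intro four_square_sumsI[of _ 0 0 0 0]) auto
  next
    case 2
    then show ?thesis by (intro four_square_sumsI[of _ 1 0 0 0]) auto
  next
    case 3
    then have "prime (int n)" by simp
    then obtain a b m where m: "a\<^sup>2 + b\<^sup>2 + 1 = int n * m" "0 < m" "m < int n"
      by (rule prime_multiple_two_squares_plus_one)
    have "real_of_int (a\<^sup>2 + b\<^sup>2 + 1) = real n * real_of_int m"
      unfolding m(1) by simp
    then have "real n = (real_of_int (a\<^sup>2 + b\<^sup>2 + 1)) * inverse (real (nat m))"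
      using m(2) by (simp add: field_simps)
    moreover have "real_of_int (a\<^sup>2 + b\<^sup>2 + 1) \<in> four_square_sums"
      by (intro four_square_sumsI[of _ "of_int a" "of_int b" 1 0]) auto
    moreover have "real (nat m) \<in> four_square_sums" using less.IH[of "nat m"] m by linarith
    ultimately show ?thesis by (simp only: four_square_sums_mult four_square_sums_inverse)
  next
    case 4
    then obtain k where k: "k dvd n" "k \<noteq> 1" "k \<noteq> n" by (auto simp: prime_nat_iff)
    then obtain l where l: "n = k * l" by (elim dvdE)
    have "k < n" using k 4(1) dvd_imp_le[of k n] by simp
    moreover have "l < n" using k l 4(1) by (cases "k = 0"; cases "l = 0") auto
    ultimately show ?thesis
      using less.IH[of k] less.IH[of l] by (simp add: l four_square_sums_mult)
  qed
qed

lemma rational_in_four_square_sums: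
  fixes q :: real
  assumes "q \<in> \<rat>" "q \<ge> 0"
  shows "q \<in> four_square_sums"
proof -
  obtain m n :: nat where "n \<noteq> 0" "\<bar>q\<bar> = real m / real n" using Rats_abs_nat_div_natE[OF assms(1)] by metis
  then have "q = real m * inverse (real n)" using assms(2) by (simp add: divide_inverse)
  then show ?thesis
    by (simp only: four_square_sums_mult four_square_sums_inverse of_nat_in_four_square_sums)
qed

section \<open>Geometry of rational eight-space\<close>

lemma exhaust_8:
  fixes i :: 8
  shows "i = 0 \<or> i = 1 \<or> i = 2 \<or> i = 3 \<or> i = 4 \<or> i = 5 \<or> i = 6 \<or> i = 7"
proof (cases i)
  case (of_int z)
  then have "z \<in> {0,1,2,3,4,5,6,7}" by auto
  then show ?thesis using of_int by auto
qed

lemma UNIV_8: "(UNIV :: 8 set) = {0,1,2,3,4,5,6,7}"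
  using exhaust_8 by blast

lemma sum_8: "sum f (UNIV :: 8 set) = f 0 + f 1 + f 2 + f 3 + f 4 + f 5 + f 6 + f 7"
  unfolding UNIV_8 by (simp add: add.assoc)

lemma forall_8: "(\<forall>i::8. P i) \<longleftrightarrow> P 0 \<and> P 1 \<and> P 2 \<and> P 3 \<and> P 4 \<and> P 5 \<and> P 6 \<and> P 7"
  by (metis exhaust_8)

definition coords8 :: "real \<Rightarrow> real \<Rightarrow> real \<Rightarrow> real \<Rightarrow> real \<Rightarrow> real \<Rightarrow> real \<Rightarrow> real \<Rightarrow> real ^ 8" where
  "coords8 a b c d e f g h = (\<chi> i. if i = 0 then a else if i = 1 then b else if i = 2 then c
     else if i = 3 then d else if i = 4 then e else if i = 5 then f else if i = 6 then g else h)"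

lemma inner_coords8:
  "coords8 a b c d e f g h \<bullet> coords8 a' b' c' d' e' f' g' h' =
     a * a' + b * b' + c * c' + d * d' + e * e' + f * f' + g * g' + h * h'"
  by (simp add: inner_vec_def sum_8 coords8_def)

lemma coords8_rational:
  "coords8 a b c d e f g h \<in> rational_points \<longleftrightarrow>
     a \<in> \<rat> \<and> b \<in> \<rat> \<and> c \<in> \<rat> \<and> d \<in> \<rat> \<and> e \<in> \<rat> \<and> f \<in> \<rat> \<and> g \<in> \<rat> \<and> h \<in> \<rat>"
  unfolding rational_points_def by (simp add: forall_8 coords8_def)

lemma coords8_diff:
  "coords8 a b c d e f g h - coords8 a' b' c' d' e' f' g' h' =
     coords8 (a - a') (b - b') (c - c') (d - d') (e - e') (f - f') (g - g') (h - h')"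
  by (simp add: vec_eq_iff forall_8 coords8_def)

lemma rational_points_add: "x \<in> rational_points \<Longrightarrow> y \<in> rational_points \<Longrightarrow> x + y \<in> rational_points"
  by (simp add: rational_points_def)

lemma rational_points_diff: "x \<in> rational_points \<Longrightarrow> y \<in> rational_points \<Longrightarrow> x - y \<in> rational_points"
  by (simp add: rational_points_def)

lemma rational_points_scaleR: "c \<in> \<rat> \<Longrightarrow> x \<in> rational_points \<Longrightarrow> c *\<^sub>R x \<in> rational_points"
  by (simp add: rational_points_def)

lemma rational_points_zero: "0 \<in> rational_points"
  by (simp add: rational_points_def)

lemma rational_points_axis: "c \<in> \<rat> \<Longrightarrow> axis i c \<in> rational_points"
  by (simp add: rational_points_def axis_def)

lemma rational_points_sum: "(\<And>i. i \<in> I \<Longrightarrow> g i \<in> rational_points) \<Longrightarrow> sum g I \<in> rational_points"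
  by (induction I rule: infinite_finite_induct) (auto simp: rational_points_add rational_points_zero)

lemmas rational_points_intros = rational_points_add rational_points_diff rational_points_scaleR
  rational_points_zero rational_points_axis rational_points_sum

lemma inner_rational_points: "x \<in> rational_points \<Longrightarrow> y \<in> rational_points \<Longrightarrow> x \<bullet> y \<in> \<rat>"
  by (auto simp: rational_points_def inner_vec_def intro!: Rats_sum)

lemma norm_power2_rational: "x \<in> rational_points \<Longrightarrow> (norm x)\<^sup>2 \<in> \<rat>"
  by (simp add: power2_norm_eq_inner inner_rational_points)

text \<open>
  The reflection in the hyperplane orthogonal to \<open>u - v\<close> does it: its coefficients are quotients of
  inner products of rational vectors.
\<close>

lemma rational_linear_isometry_exists:
  fixes u v :: "real ^ 'n"
  assumes "u \<in> rational_points" "v \<in> rational_points" "norm u = norm v"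
  obtains R where "linear R" "\<And>z. norm (R z) = norm z"
    "\<And>z. z \<in> rational_points \<Longrightarrow> R z \<in> rational_points" "R u = v"
proof (cases "u = v")
  case True
  then show ?thesis using that[of id] by (simp add: linear_id)
next
  case False
  define n where "n = u - v"
  define R where "R = (\<lambda>z. z - (2 * (z \<bullet> n) / (n \<bullet> n)) *\<^sub>R n)"
  have n0: "n \<bullet> n \<noteq> 0" using False by (simp add: n_def)
  have nr: "n \<in> rational_points" using assms by (simp add: n_def rational_points_diff)
  show ?thesis
  proof
    show "linear R"
      unfolding R_def
      by (intro linearI) (simp_all add: inner_add_left add_divide_distrib algebra_simps)
    show "norm (R z) = norm z" for z
    proof -
      have "R z \<bullet> R z = z \<bullet> z"
        using n0 by (simp add: R_def inner_diff_left inner_diff_right inner_commute field_simps power2_eq_square)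
      then show ?thesis by (simp add: norm_eq_sqrt_inner)
    qed
    show "R z \<in> rational_points" if "z \<in> rational_points" for z
      unfolding R_def using that nr
      by (intro rational_points_intros Rats_divide Rats_mult inner_rational_points) auto
    have "u \<bullet> u = v \<bullet> v" using assms(3) by (simp add: norm_eq)
    then have "n \<bullet> n = 2 * (u \<bullet> n)"
      by (simp add: n_def inner_diff_left inner_diff_right inner_commute)
    then show "R u = v" using n0 by (simp add: R_def n_def)
  qed
qed

lemma linear_isometry_preserves_inner:
  fixes R :: "'a::real_inner \<Rightarrow> 'b::real_inner"
  assumes "linear R" "\<And>z. norm (R z) = norm z"
  shows "R x \<bullet> R y = x \<bullet> y"
  using assms by (simp add: dot_norm linear_add[symmetric])

text \<open>
  All triangles used below are built on this: \<open>u\<close> can be moved by a rational isometry to a vector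
  supported on the first four coordinates, and the vectors supported on the last four coordinates
  attain every nonnegative rational as squared length.
\<close>

lemma rational_perpendicular_exists:
  fixes u :: "real ^ 8"
  assumes "u \<in> rational_points" "s \<in> \<rat>" "s \<ge> 0"
  obtains w where "w \<in> rational_points" "w \<bullet> u = 0" "(norm w)\<^sup>2 = s"
proof -
  obtain a b c d where abcd: "(norm u)\<^sup>2 = a\<^sup>2 + b\<^sup>2 + c\<^sup>2 + d\<^sup>2" "a \<in> \<rat>" "b \<in> \<rat>" "c \<in> \<rat>" "d \<in> \<rat>"
    by (rule four_square_sumsE[OF rational_in_four_square_sums[OF norm_power2_rational[OF assms(1)]]]) auto
  obtain e f g h where efgh: "s = e\<^sup>2 + f\<^sup>2 + g\<^sup>2 + h\<^sup>2" "e \<in> \<rat>" "f \<in> \<rat>" "g \<in> \<rat>" "h \<in> \<rat>"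
    by (rule four_square_sumsE[OF rational_in_four_square_sums[OF assms(2,3)]])
  let ?u = "coords8 a b c d 0 0 0 0" and ?w = "coords8 0 0 0 0 e f g h"
  have "(norm ?u)\<^sup>2 = (norm u)\<^sup>2"
    unfolding abcd(1) unfolding power2_norm_eq_inner inner_coords8 by (simp add: power2_eq_square)
  then have "norm ?u = norm u" by simp
  moreover have "?u \<in> rational_points" using abcd by (simp add: coords8_rational)
  ultimately obtain R where R: "linear R" "\<And>z. norm (R z) = norm z"
    "\<And>z. z \<in> rational_points \<Longrightarrow> R z \<in> rational_points" "R ?u = u"
    using rational_linear_isometry_exists assms(1) by metis
  show ?thesis
  proof
    show "R ?w \<in> rational_points" using efgh by (intro R(3)) (simp add: coords8_rational)
    have "R ?w \<bullet> R ?u = ?w \<bullet> ?u" by (rule linear_isometry_preserves_inner[OF R(1,2)])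
    then show "R ?w \<bullet> u = 0" by (simp add: R(4) inner_coords8)
    show "(norm (R ?w))\<^sup>2 = s"
      unfolding R(2) efgh(1) power2_norm_eq_inner inner_coords8 by (simp add: power2_eq_square)
  qed
qed

section \<open>Rigid distances\<close>

definition rigid_pair :: "real ^ 8 \<Rightarrow> real ^ 8 \<Rightarrow> bool" where
  "rigid_pair x y \<longleftrightarrow> (\<exists>S. finite S \<and> S \<subseteq> rational_points \<and> x \<in> S \<and> y \<in> S \<and>
    (\<forall>f :: real ^ 8 \<Rightarrow> real ^ 8. preserves_unit_distance_on S f \<longrightarrow>
        norm (f x - f y) = norm (x - y)))"

definition rigid_distances :: "real set" where
  "rigid_distances = {d. \<forall>x\<in>rational_points. \<forall>y\<in>rational_points. norm (x - y) = d \<longrightarrow> rigid_pair x y}"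

lemma one_rigid: "1 \<in> rigid_distances"
proof -
  have "rigid_pair x y" if "x \<in> rational_points" "y \<in> rational_points" "norm (x - y) = 1" for x y
    unfolding rigid_pair_def
    by (rule exI[of _ "{x, y}"]) (use that in \<open>auto simp: preserves_unit_distance_on_def\<close>)
  then show ?thesis by (auto simp: rigid_distances_def)
qed

text \<open>
  If \<open>T\<close> is a rational isometry carrying one pair to the other and \<open>S\<close> works for the first pair,
  then \<open>T ` S\<close> works for the second, since \<open>f \<circ> T\<close> preserves unit distances on \<open>S\<close> when \<open>f\<close>
  does on \<open>T ` S\<close>.
\<close>

lemma rigid_pair_transport:
  assumes rat: "x \<in> rational_points" "y \<in> rational_points" "x' \<in> rational_points" "y' \<in> rational_points"
    and eq: "norm (x - y) = norm (x' - y')" and rigid: "rigid_pair x y"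
  shows "rigid_pair x' y'"
proof -
  obtain R where R: "linear R" "\<And>z. norm (R z) = norm z"
    "\<And>z. z \<in> rational_points \<Longrightarrow> R z \<in> rational_points" "R (y - x) = y' - x'"
    using rational_linear_isometry_exists[of "y - x" "y' - x'"] rat eq
    by (metis norm_minus_commute rational_points_diff)
  define T where "T = (\<lambda>z. x' + R (z - x))"
  have T_dist: "norm (T a - T b) = norm (a - b)" for a b
    using R(2)[of "a - b"] by (simp add: T_def linear_diff[OF R(1)])
  have T_xy: "T x = x'" "T y = y'" by (simp_all add: T_def R(4) linear_0[OF R(1)])
  have T_rat: "T z \<in> rational_points" if "z \<in> rational_points" for z
    unfolding T_def using that rat by (intro rational_points_intros R(3))
  obtain S where S: "finite S" "S \<subseteq> rational_points" "x \<in> S" "y \<in> S"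
    "\<And>f :: real ^ 8 \<Rightarrow> real ^ 8. preserves_unit_distance_on S f \<Longrightarrow> norm (f x - f y) = norm (x - y)"
    using rigid unfolding rigid_pair_def by blast
  show ?thesis
    unfolding rigid_pair_def
  proof (intro exI[of _ "T ` S"] conjI allI impI)
    show "finite (T ` S)" "T ` S \<subseteq> rational_points" using S T_rat by auto
    show "x' \<in> T ` S" "y' \<in> T ` S" using S(3,4) T_xy by (metis imageI)+
    fix f :: "real ^ 8 \<Rightarrow> real ^ 8"
    assume "preserves_unit_distance_on (T ` S) f"
    then have "preserves_unit_distance_on S (f \<circ> T)"
      by (simp add: preserves_unit_distance_on_def T_dist)
    from S(5)[OF this] show "norm (f x' - f y') = norm (x' - y')" by (simp add: T_xy eq)
  qed
qed

text \<open>
  The principle behind every later step. The set \<open>T\<close> is enlarged by a witnessing finite set for each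
  of its pairs at a rigid distance, so that a unit preserving map on the union keeps all those
  distances. Transport then turns the result for the one pair \<open>x, y\<close> into a result for all pairs at
  the same distance.
\<close>

lemma rigid_distanceI:
  assumes T: "finite T" "T \<subseteq> rational_points" "x \<in> T" "y \<in> T"
    and forced: "\<And>f :: real ^ 8 \<Rightarrow> real ^ 8.
      (\<And>a b. a \<in> T \<Longrightarrow> b \<in> T \<Longrightarrow> norm (a - b) \<in> rigid_distances \<Longrightarrow> norm (f a - f b) = norm (a - b)) \<Longrightarrow>
      norm (f x - f y) = norm (x - y)"
  shows "norm (x - y) \<in> rigid_distances"
proof -
  define E where "E = {(a, b). a \<in> T \<and> b \<in> T \<and> norm (a - b) \<in> rigid_distances}"
  have "finite E" by (rule finite_subset[of _ "T \<times> T"]) (use T in \<open>auto simp: E_def\<close>)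
  have "\<forall>e\<in>E. rigid_pair (fst e) (snd e)"
    using T(2) by (auto simp: E_def rigid_distances_def)
  then obtain G where G: "\<And>e. e \<in> E \<Longrightarrow> finite (G e) \<and> G e \<subseteq> rational_points \<and>
      (\<forall>f :: real ^ 8 \<Rightarrow> real ^ 8. preserves_unit_distance_on (G e) f \<longrightarrow>
        norm (f (fst e) - f (snd e)) = norm (fst e - snd e))"
    unfolding rigid_pair_def by metis
  define S where "S = T \<union> (\<Union>e\<in>E. G e)"
  have "rigid_pair x y"
    unfolding rigid_pair_def
  proof (intro exI[of _ S] conjI allI impI)
    show "finite S" using T \<open>finite E\<close> G by (auto simp: S_def)
    show "S \<subseteq> rational_points" using T G by (auto simp: S_def)
    show "x \<in> S" "y \<in> S" using T by (auto simp: S_def)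
    fix f :: "real ^ 8 \<Rightarrow> real ^ 8"
    assume f: "preserves_unit_distance_on S f"
    show "norm (f x - f y) = norm (x - y)"
    proof (rule forced)
      fix a b assume "a \<in> T" "b \<in> T" "norm (a - b) \<in> rigid_distances"
      then have e: "(a, b) \<in> E" by (simp add: E_def)
      then have "preserves_unit_distance_on (G (a, b)) f"
        using f by (auto simp: preserves_unit_distance_on_def S_def)
      then show "norm (f a - f b) = norm (a - b)" using G[OF e] by auto
    qed
  qed
  moreover have "x \<in> rational_points" "y \<in> rational_points" using T by auto
  ultimately show ?thesis
    unfolding rigid_distances_def
    by (intro CollectI ballI impI) (rule rigid_pair_transport[of x y], simp_all)
qed

section \<open>Mirror images of an apex of a unit simplex\<close>

text \<open>
  The apex \<open>a\<close> of a simplex is separated from its facet \<open>q\<close> because the facet stays fixed when the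
  apex is mirrored. Indexing the facet by the coordinate type \<open>'n\<close> supplies exactly as many edge
  vectors \<open>q i - a\<close> as the dimension of the space.
\<close>

definition unit_simplex :: "real ^ 'n \<Rightarrow> ('n \<Rightarrow> real ^ 'n) \<Rightarrow> bool" where
  "unit_simplex a q \<longleftrightarrow> (\<forall>i. norm (q i - a) = 1) \<and> (\<forall>i j. i \<noteq> j \<longrightarrow> norm (q i - q j) = 1)"

text \<open>
  The reflection of \<open>a\<close> in the hyperplane through the \<open>q i\<close> when these form a unit simplex with
  \<open>a\<close>; the foot of the perpendicular is then the centroid of the facet. As an affine combination of
  the points \<open>a, q i\<close>, it makes sense for arbitrary points and exposes the weight \<open>2 / n\<close> of
  each \<open>q i\<close>.
\<close>

definition mirror :: "real ^ 'n \<Rightarrow> ('n \<Rightarrow> real ^ 'n) \<Rightarrow> real ^ 'n" where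
  "mirror a q = a + (2 / real CARD('n)) *\<^sub>R (\<Sum>i\<in>UNIV. q i - a)"

lemma unit_simplex_inner:
  assumes "unit_simplex a q"
  shows "(q i - a) \<bullet> (q j - a) = (if i = j then 1 else 1 / 2)"
proof -
  have "(norm (q i - q j))\<^sup>2 = (norm (q i - a))\<^sup>2 + (norm (q j - a))\<^sup>2 - 2 * ((q i - a) \<bullet> (q j - a))"
    by (simp add: power2_norm_eq_inner inner_diff_left inner_diff_right inner_commute)
  then show ?thesis using assms by (auto simp: unit_simplex_def power2_norm_eq_inner[symmetric])
qed

text \<open>
  The edge vectors from the apex span the space: their Gram matrix \<open>(I + J) / 2\<close>, with \<open>J\<close> the
  all-ones matrix, is nonsingular, so forming linear combinations of them is injective and hence,
  in the right dimension, surjective.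
\<close>

lemma unit_simplex_orthogonal_eq_0:
  fixes q :: "'n::finite \<Rightarrow> real ^ 'n"
  assumes "unit_simplex a q" and z: "\<And>i. z \<bullet> (q i - a) = 0"
  shows "z = 0"
proof -
  define L where "L = (\<lambda>c :: real ^ 'n. \<Sum>i\<in>UNIV. (c $ i) *\<^sub>R (q i - a))"
  have lin: "linear L"
    unfolding L_def
    by (intro linearI) (simp_all add: scaleR_left_distrib sum.distrib scaleR_sum_right)
  have L_inner: "L c \<bullet> (q j - a) = (c $ j + (\<Sum>i\<in>UNIV. c $ i)) / 2" for c j
  proof -
    have "L c \<bullet> (q j - a) = (\<Sum>i\<in>UNIV. c $ i * (if i = j then 1 else 1 / 2))"
      unfolding L_def inner_sum_left by (simp add: unit_simplex_inner[OF assms(1)])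
    also have "\<dots> = (\<Sum>i\<in>UNIV. c $ i / 2 + (if i = j then c $ i / 2 else 0))"
      by (intro sum.cong) auto
    also have "\<dots> = (c $ j + (\<Sum>i\<in>UNIV. c $ i)) / 2"
      by (simp add: sum.distrib sum_divide_distrib add_divide_distrib)
    finally show ?thesis .
  qed
  have "inj L"
    unfolding linear_injective_0[OF lin]
  proof (intro allI impI)
    fix c assume "L c = 0"
    define s where "s = (\<Sum>i\<in>UNIV. c $ i)"
    have c: "c $ j = - s" for j using L_inner[of c j] \<open>L c = 0\<close> by (simp add: s_def)
    have "(\<Sum>i\<in>UNIV. c $ i) = (\<Sum>i\<in>(UNIV :: 'n set). - s)" by (rule sum.cong) (simp_all only: c)
    then have "s = (\<Sum>i\<in>(UNIV :: 'n set). - s)" by (simp only: s_def)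
    then have "s * (1 + real CARD('n)) = 0" by (simp add: algebra_simps)
    then have "s = 0" by (smt (verit) mult_eq_0_iff of_nat_0_le_iff)
    then show "c = 0" using c by (simp add: vec_eq_iff)
  qed
  then have "surj L" by (rule linear_inj_imp_surj[OF lin])
  then obtain c where "z = L c" by blast
  then have "z \<bullet> z = (\<Sum>i\<in>UNIV. c $ i * (z \<bullet> (q i - a)))"
    by (metis (no_types, lifting) L_def inner_commute inner_scaleR_right inner_sum_right sum.cong)
  then show ?thesis by (simp add: z)
qed

lemma unit_simplex_inner_sum:
  fixes q :: "'n::finite \<Rightarrow> real ^ 'n"
  assumes "unit_simplex a q"
  shows "(\<Sum>i\<in>UNIV. q i - a) \<bullet> (q j - a) = (real CARD('n) + 1) / 2"
proof -
  have "(\<Sum>i\<in>UNIV. q i - a) \<bullet> (q j - a) = (\<Sum>i\<in>UNIV. 1 / 2 + (if i = j then 1 / 2 else 0 :: real))"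
    unfolding inner_sum_left by (intro sum.cong) (simp_all add: unit_simplex_inner[OF assms])
  also have "\<dots> = (real CARD('n) + 1) / 2" by (simp add: sum.distrib add_divide_distrib)
  finally show ?thesis .
qed

lemma unit_simplex_norm_sum:
  fixes q :: "'n::finite \<Rightarrow> real ^ 'n"
  assumes "unit_simplex a q"
  shows "(norm (\<Sum>i\<in>UNIV. q i - a))\<^sup>2 = real CARD('n) * (real CARD('n) + 1) / 2"
  unfolding power2_norm_eq_inner
  by (subst inner_sum_right) (simp add: unit_simplex_inner_sum[OF assms])

lemma mirror_unit_distance:
  fixes q :: "'n::finite \<Rightarrow> real ^ 'n"
  assumes "unit_simplex a q"
  shows "norm (q j - mirror a q) = 1"
proof -
  define n where "n = real CARD('n)"
  define u where "u = (\<Sum>i\<in>UNIV. q i - a)"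
  have n: "n > 0" by (simp add: n_def)
  have u: "u \<bullet> (q j - a) = (n + 1) / 2" "u \<bullet> u = n * (n + 1) / 2"
    using unit_simplex_inner_sum[OF assms, of j] unit_simplex_norm_sum[OF assms]
    by (simp_all add: u_def n_def power2_norm_eq_inner)
  have "(norm (q j - mirror a q))\<^sup>2 = (norm ((q j - a) - (2 / n) *\<^sub>R u))\<^sup>2"
    by (simp add: mirror_def n_def u_def algebra_simps)
  also have "\<dots> = (norm (q j - a))\<^sup>2 - 2 * (2 / n) * (u \<bullet> (q j - a)) + (2 / n)\<^sup>2 * (u \<bullet> u)"
    unfolding power2_norm_eq_inner inner_diff_left[of "q j - a"] inner_diff_right[of _ "q j - a"]
    by (simp add: inner_commute power2_eq_square)
  also have "\<dots> = 1"
    using assms n by (simp add: u unit_simplex_def power2_eq_square field_simps)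
  finally show ?thesis using power2_eq_1_iff[of "norm (q j - mirror a q)"]
    by (smt (verit) norm_ge_zero)
qed

lemma mirror_apex_distance:
  fixes q :: "'n::finite \<Rightarrow> real ^ 'n"
  assumes "unit_simplex a q"
  shows "(norm (a - mirror a q))\<^sup>2 = 2 * (real CARD('n) + 1) / real CARD('n)"
proof -
  have "(norm (a - mirror a q))\<^sup>2 = (2 / real CARD('n))\<^sup>2 * (norm (\<Sum>i\<in>UNIV. q i - a))\<^sup>2"
    by (simp add: mirror_def power_mult_distrib power_divide)
  then show ?thesis
    unfolding unit_simplex_norm_sum[OF assms] by (simp add: divide_simps power2_eq_square)
qed

text \<open>
  Being at unit distance from all \<open>q i\<close> prescribes the inner products of \<open>w = b - a\<close> with the
  edge vectors in terms of \<open>norm w\<close>: they are all equal. The sum \<open>u\<close> of the edge vectors also has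
  equal inner products with them, so \<open>w\<close> is a multiple \<open>t\<close> of \<open>u\<close>. Comparing lengths leaves a
  quadratic equation for \<open>t\<close>, with one solution for \<open>b = a\<close> and one for the mirror image.
\<close>

lemma two_apexes:
  fixes q :: "'n::finite \<Rightarrow> real ^ 'n"
  assumes simplex: "unit_simplex a q" and b: "\<And>i. norm (q i - b) = 1" and "b \<noteq> a"
  shows "b = mirror a q"
proof -
  define n where "n = real CARD('n)"
  define u where "u = (\<Sum>i\<in>UNIV. q i - a)"
  define w where "w = b - a"
  define t where "t = (norm w)\<^sup>2 / (n + 1)"
  have n: "n > 0" by (simp add: n_def)
  have "(w - t *\<^sub>R u) \<bullet> (q i - a) = 0" for i
  proof -
    have "(norm (q i - b))\<^sup>2 = (norm (q i - a))\<^sup>2 - 2 * (w \<bullet> (q i - a)) + (norm w)\<^sup>2"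
      unfolding w_def power2_norm_eq_inner
      by (simp add: inner_diff_left inner_diff_right inner_commute)
    then have wq: "w \<bullet> (q i - a) = (norm w)\<^sup>2 / 2"
      using b[of i] simplex by (simp add: unit_simplex_def)
    have uq: "u \<bullet> (q i - a) = (n + 1) / 2"
      using unit_simplex_inner_sum[OF simplex] by (simp add: u_def n_def)
    show ?thesis using n
      unfolding inner_diff_left[of w] inner_scaleR_left wq uq t_def by simp
  qed
  then have w: "w = t *\<^sub>R u" using unit_simplex_orthogonal_eq_0[OF simplex, of "w - t *\<^sub>R u"] by simp
  have "(norm w)\<^sup>2 = t\<^sup>2 * (n * (n + 1) / 2)"
    unfolding w using unit_simplex_norm_sum[OF simplex]
    by (simp add: power_mult_distrib u_def n_def)
  moreover have "(norm w)\<^sup>2 = t * (n + 1)" using n by (simp add: t_def)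
  ultimately have "t * (n + 1) = t\<^sup>2 * (n * (n + 1) / 2)" by simp
  moreover have "t\<^sup>2 * (n * (n + 1) / 2) = t * (n + 1) * (n * t / 2)"
    by (simp add: power2_eq_square)
  moreover have "t * (n + 1) \<noteq> 0" using \<open>b \<noteq> a\<close> n by (simp add: t_def w_def)
  ultimately have "n * t / 2 = 1" by (simp only: mult_cancel_left1) simp
  then have "t = 2 / n" using n by (simp add: field_simps)
  then show ?thesis using w by (simp add: mirror_def w_def u_def n_def algebra_simps)
qed

lemma unit_simplex_mirror: "unit_simplex a q \<Longrightarrow> unit_simplex (mirror a q) q"
  by (auto simp: unit_simplex_def mirror_unit_distance)

lemma unit_simplex_swap: "unit_simplex a q \<Longrightarrow> unit_simplex (q k) (q(k := a))"
  by (auto simp: unit_simplex_def norm_minus_commute)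

lemma mirror_rational:
  "a \<in> rational_points \<Longrightarrow> range q \<subseteq> rational_points \<Longrightarrow> mirror a q \<in> rational_points"
  unfolding mirror_def by (intro rational_points_intros) auto

text \<open>
  The source of a shorter distance: moving one facet vertex from \<open>a\<close> to \<open>b\<close> moves the mirror image
  by a fraction \<open>2 / n\<close> of that displacement.
\<close>

lemma mirror_swap_diff:
  fixes q :: "'n::finite \<Rightarrow> real ^ 'n"
  shows "mirror (q k) (q(k := b)) - mirror (q k) (q(k := a)) = (2 / real CARD('n)) *\<^sub>R (b - a)"
proof -
  have *: "(\<Sum>i\<in>UNIV. (q(k := c)) i - q k) = (c - q k) + (\<Sum>i\<in>UNIV - {k}. q i - q k)" for c
    by (subst sum.remove[of _ k]) (auto intro!: sum.cong)
  show ?thesis unfolding mirror_def * by (simp add: algebra_simps)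
qed

lemma mirror_apex_distance_8:
  fixes q :: "8 \<Rightarrow> real ^ 8"
  assumes "unit_simplex a q"
  shows "norm (a - mirror a q) = 3 / 2"
proof -
  have "(norm (a - mirror a q))\<^sup>2 = (3 / 2)\<^sup>2"
    using mirror_apex_distance[OF assms] by (simp add: power2_eq_square)
  then show ?thesis by (rule power2_eq_imp_eq) auto
qed

text \<open>
  Together with the origin, the vertices of a unit simplex. The last seven vectors are the
  characteristic vectors of the lines of a Fano plane on the coordinates 1 to 7, extended by
  coordinate 0 and halved. Any two lines meet in one point, so two of these vectors share two of
  their four nonzero coordinates and have inner product \<open>1 / 2\<close>.
\<close>

definition fano_simplex :: "8 \<Rightarrow> real ^ 8" where
  "fano_simplex i = (1 / 2) *\<^sub>R
     (if i = 0 then coords8 2 0 0 0 0 0 0 0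
      else if i = 1 then coords8 1 1 0 0 0 0 1 1
      else if i = 2 then coords8 1 0 1 0 0 1 0 1
      else if i = 3 then coords8 1 0 0 1 0 1 1 0
      else if i = 4 then coords8 1 1 1 1 0 0 0 0
      else if i = 5 then coords8 1 1 0 0 1 1 0 0
      else if i = 6 then coords8 1 0 1 0 1 0 1 0
      else coords8 1 0 0 1 1 0 0 1)"

lemma fano_simplex_rational: "fano_simplex i \<in> rational_points"
  unfolding fano_simplex_def by (intro rational_points_scaleR) (auto simp: coords8_rational)

lemma unit_simplex_fano: "unit_simplex 0 fano_simplex"
proof -
  have "\<forall>i. norm (fano_simplex i - 0) = 1"
    by (simp add: forall_8 fano_simplex_def norm_eq_sqrt_inner inner_coords8)
  moreover have "\<forall>i j. i \<noteq> j \<longrightarrow> norm (fano_simplex i - fano_simplex j) = 1"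
    unfolding fano_simplex_def scaleR_diff_right[symmetric]
    by (simp add: forall_8 norm_eq_sqrt_inner inner_coords8 coords8_diff)
  ultimately show ?thesis by (simp add: unit_simplex_def)
qed

lemma rational_simplex_with_mirror:
  fixes x y :: "real ^ 8"
  assumes "x \<in> rational_points" "y \<in> rational_points" "norm (x - y) = 3 / 2"
  obtains q where "unit_simplex x q" "range q \<subseteq> rational_points" "y = mirror x q"
proof -
  let ?m = "mirror 0 fano_simplex"
  have "norm ?m = norm (y - x)"
    using mirror_apex_distance_8[OF unit_simplex_fano] assms(3) by (simp add: norm_minus_commute)
  moreover have "?m \<in> rational_points"
    using fano_simplex_rational by (intro mirror_rational rational_points_zero) auto
  moreover have "y - x \<in> rational_points" using assms(1,2) by (intro rational_points_diff)
  ultimately obtain R where R: "linear R" "\<And>z. norm (R z) = norm z"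
    "\<And>z. z \<in> rational_points \<Longrightarrow> R z \<in> rational_points" "R ?m = y - x"
    using rational_linear_isometry_exists[of ?m "y - x"] by metis
  define q where "q = (\<lambda>i. x + R (fano_simplex i))"
  show ?thesis
  proof
    show "unit_simplex x q"
      using unit_simplex_fano
      by (simp add: unit_simplex_def q_def R(2) linear_diff[OF R(1), symmetric])
    show "range q \<subseteq> rational_points"
      using assms(1) fano_simplex_rational R(3) by (auto simp: q_def intro: rational_points_add)
    have "mirror x q = x + R ?m"
      by (simp add: mirror_def q_def linear_cmul[OF R(1)] linear_sum[OF R(1)])
    then show "y = mirror x q" by (simp add: R(4))
  qed
qed

section \<open>Multiples of three eighths\<close>

text \<open>
  Facets of unit simplices over the pairs \<open>x, y\<close> and \<open>x, y'\<close> force each image pair to coincide or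
  to have distance \<open>3 / 2\<close>. If \<open>f x = f y\<close>, then \<open>f x\<close> and \<open>f y'\<close> have distance
  \<open>norm (y - y') = 1\<close>, which is neither \<open>0\<close> nor \<open>3 / 2\<close>.
\<close>

lemma three_halves_rigid: "3 / 2 \<in> rigid_distances"
proof -
  define x y y' where "x = coords8 0 0 0 0 0 0 0 0"
    and "y = coords8 1 1 (1/2) 0 0 0 0 0" and "y' = coords8 1 1 (-1/2) 0 0 0 0 0"
  have rat: "x \<in> rational_points" "y \<in> rational_points" "y' \<in> rational_points"
    by (simp_all add: x_def y_def y'_def coords8_rational)
  have "sqrt (9 / 4) = 3 / 2" by (rule real_sqrt_unique) (auto simp: power2_eq_square)
  then have dist: "norm (x - y) = 3 / 2" "norm (x - y') = 3 / 2" "norm (y - y') = 1"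
    by (simp_all add: x_def y_def y'_def coords8_diff norm_eq_sqrt_inner inner_coords8)
  obtain q where q: "unit_simplex x q" "range q \<subseteq> rational_points" "y = mirror x q"
    using rational_simplex_with_mirror[OF rat(1,2) dist(1)] .
  obtain q' where q': "unit_simplex x q'" "range q' \<subseteq> rational_points" "y' = mirror x q'"
    using rational_simplex_with_mirror[OF rat(1,3) dist(2)] .
  let ?T = "{x, y, y'} \<union> range q \<union> range q'"
  have "norm (x - y) \<in> rigid_distances"
  proof (rule rigid_distanceI[of ?T])
    show "finite ?T" "?T \<subseteq> rational_points" "x \<in> ?T" "y \<in> ?T" using rat q q' by auto
    fix f :: "real ^ 8 \<Rightarrow> real ^ 8"
    assume f: "\<And>a b. a \<in> ?T \<Longrightarrow> b \<in> ?T \<Longrightarrow> norm (a - b) \<in> rigid_distances \<Longrightarrow>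
      norm (f a - f b) = norm (a - b)"
    have f1: "norm (f a - f b) = 1" if "norm (a - b) = 1" "a \<in> ?T" "b \<in> ?T" for a b
      using f[OF that(2,3)] that(1) one_rigid by simp
    have apex: "f z = f x \<or> norm (f x - f z) = 3 / 2"
      if r: "unit_simplex x r" "z = mirror x r" "range r \<subseteq> ?T" and z: "z \<in> ?T" for z r
    proof -
      have in_T: "r i \<in> ?T" for i using r(3) by blast
      have "unit_simplex (f x) (f \<circ> r)"
        using r(1) f1 in_T unfolding unit_simplex_def by simp
      moreover have "norm ((f \<circ> r) i - f z) = 1" for i
        using f1[OF _ in_T z] mirror_unit_distance[OF r(1)] r(2) by simp
      ultimately show ?thesis using two_apexes mirror_apex_distance_8 by metis
    qed
    have "f y = f x \<or> norm (f x - f y) = 3 / 2" by (rule apex[OF q(1,3)]) auto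
    moreover have "f y' = f x \<or> norm (f x - f y') = 3 / 2" by (rule apex[OF q'(1,3)]) auto
    moreover have "norm (f y - f y') = 1" by (rule f1[OF dist(3)]) auto
    ultimately show "norm (f x - f y) = norm (x - y)" using dist(1) by auto
  qed
  then show ?thesis by (simp add: dist(1))
qed

text \<open>
  With \<open>1\<close> and \<open>3 / 2\<close> rigid, an admissible map commutes with \<open>mirror\<close> on the unit simplices of
  the configuration. Let \<open>a'\<close> be the mirror image of the apex \<open>0\<close>. Mirroring the facet vertex
  \<open>q 0\<close> once in the simplex containing \<open>0\<close> and once in the simplex containing \<open>a'\<close> gives \<open>b\<close>
  and \<open>c\<close>, and both \<open>c - b\<close> and its image are a quarter of the respective difference of \<open>a'\<close> and
  \<open>0\<close>.
\<close>

lemma three_eighths_rigid: "3 / 8 \<in> rigid_distances"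
proof -
  define q where "q = fano_simplex"
  define a' where "a' = mirror 0 q"
  define b where "b = mirror (q 0) (q(0 := 0))"
  define c where "c = mirror (q 0) (q(0 := a'))"
  let ?T = "{0, a', b, c} \<union> range q"
  have s: "unit_simplex 0 q" "unit_simplex a' q"
    using unit_simplex_fano unit_simplex_mirror by (auto simp: q_def a'_def)
  note sb = unit_simplex_swap[OF s(1), of 0] and sc = unit_simplex_swap[OF s(2), of 0]
  have q_rat: "q i \<in> rational_points" for i by (simp add: q_def fano_simplex_rational)
  have a'_rat: "a' \<in> rational_points"
    unfolding a'_def using q_rat by (intro mirror_rational rational_points_zero) auto
  have bc_rat: "b \<in> rational_points" "c \<in> rational_points"
    unfolding b_def c_def using q_rat a'_rat rational_points_zero by (auto intro!: mirror_rational)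
  have cb: "c - b = (1 / 4) *\<^sub>R (a' - 0)"
    unfolding b_def c_def mirror_swap_diff by simp
  have a'_norm: "norm (0 - a') = 3 / 2"
    unfolding a'_def by (rule mirror_apex_distance_8[OF s(1)])
  have "norm (c - b) \<in> rigid_distances"
  proof (rule rigid_distanceI[of ?T])
    show "finite ?T" "?T \<subseteq> rational_points" "c \<in> ?T" "b \<in> ?T"
      using q_rat a'_rat bc_rat rational_points_zero by auto
    fix f :: "real ^ 8 \<Rightarrow> real ^ 8"
    assume f: "\<And>a b. a \<in> ?T \<Longrightarrow> b \<in> ?T \<Longrightarrow> norm (a - b) \<in> rigid_distances \<Longrightarrow>
      norm (f a - f b) = norm (a - b)"
    have f1: "norm (f a - f b) = 1" if "norm (a - b) = 1" "a \<in> ?T" "b \<in> ?T" for a b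
      using f[OF that(2,3)] that(1) one_rigid by simp
    have f_mirror: "f (mirror a r) = mirror (f a) (f \<circ> r)"
      if r: "unit_simplex a r" "range r \<subseteq> ?T" "a \<in> ?T" "mirror a r \<in> ?T" for a r
    proof (rule two_apexes)
      have in_T: "r i \<in> ?T" for i using r(2) by blast
      show "unit_simplex (f a) (f \<circ> r)"
        using r(1) f1 in_T r(3) unfolding unit_simplex_def by simp
      show "norm ((f \<circ> r) i - f (mirror a r)) = 1" for i
        using f1[OF _ in_T r(4)] mirror_unit_distance[OF r(1)] by simp
      have "norm (f a - f (mirror a r)) = 3 / 2"
        using f[OF r(3,4)] mirror_apex_distance_8[OF r(1)] three_halves_rigid by simp
      then show "f (mirror a r) \<noteq> f a" by auto
    qed
    have "f b = mirror (f (q 0)) (f \<circ> q(0 := 0))"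
      unfolding b_def by (rule f_mirror[OF sb]) (auto simp: b_def)
    moreover have "f c = mirror (f (q 0)) (f \<circ> q(0 := a'))"
      unfolding c_def by (rule f_mirror[OF sc]) (auto simp: c_def)
    ultimately have "f c - f b = (1 / 4) *\<^sub>R (f a' - f 0)"
      using mirror_swap_diff[of "f \<circ> q" 0 "f a'" "f 0"] by (simp add: fun_upd_comp)
    moreover have "norm (f 0 - f a') = 3 / 2"
      using f[of 0 a'] unfolding a'_norm using three_halves_rigid by simp
    ultimately show "norm (f c - f b) = norm (c - b)"
      using a'_norm by (simp add: cb norm_minus_commute)
  qed
  moreover have "norm (c - b) = 3 / 8" using a'_norm by (simp add: cb)
  ultimately show ?thesis by simp
qed

definition ladder :: "nat \<Rightarrow> real ^ 8" where
  "ladder i = axis 0 (3 / 8 * real i)"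

lemma ladder_rational: "ladder i \<in> rational_points"
  unfolding ladder_def by (intro rational_points_axis) simp

lemma norm_axis: "norm (axis i c :: real ^ 'n) = \<bar>c\<bar>"
  by (simp add: norm_eq_sqrt_inner inner_axis_axis)

lemma norm_ladder_diff:
  assumes "i \<le> j"
  shows "norm (ladder j - ladder i) = 3 / 8 * (real j - real i)"
proof -
  have "ladder j - ladder i = axis 0 (3 / 8 * (real j - real i))"
    unfolding ladder_def right_diff_distrib by (simp add: axis_def vec_eq_iff)
  then show ?thesis using assms by (simp add: norm_axis)
qed

text \<open>
  The images of five consecutive rungs span \<open>3 / 2 = 4 * (3 / 8)\<close> with four steps of length
  \<open>3 / 8\<close>, so neither half can be shorter than two full steps.
\<close>

lemma three_quarters_rigid: "3 / 4 \<in> rigid_distances"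
proof -
  let ?T = "ladder ` {..4}"
  have "norm (ladder 2 - ladder 0) \<in> rigid_distances"
  proof (rule rigid_distanceI[of ?T])
    show "finite ?T" "?T \<subseteq> rational_points" "ladder 2 \<in> ?T" "ladder 0 \<in> ?T"
      using ladder_rational by auto
    fix f :: "real ^ 8 \<Rightarrow> real ^ 8"
    assume f: "\<And>a b. a \<in> ?T \<Longrightarrow> b \<in> ?T \<Longrightarrow> norm (a - b) \<in> rigid_distances \<Longrightarrow>
      norm (f a - f b) = norm (a - b)"
    have step: "norm (f (ladder (Suc i)) - f (ladder i)) = 3 / 8" if "i < 4" for i
      using f[of "ladder (Suc i)" "ladder i"] that norm_ladder_diff[of i "Suc i"] three_eighths_rigid by simp
    have long: "norm (f (ladder 4) - f (ladder 0)) = 3 / 2"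
      using f[of "ladder 4" "ladder 0"] norm_ladder_diff[of 0 4] three_halves_rigid by simp
    have "norm (f (ladder 2) - f (ladder 0)) \<le> 3 / 4" "norm (f (ladder 4) - f (ladder 2)) \<le> 3 / 4"
      using step[of 0] step[of 1] step[of 2] step[of 3]
        norm_triangle_ineq[of "f (ladder 2) - f (ladder 1)" "f (ladder 1) - f (ladder 0)"]
        norm_triangle_ineq[of "f (ladder 4) - f (ladder 3)" "f (ladder 3) - f (ladder 2)"]
      by (simp_all add: numeral_eq_Suc)
    moreover have "3 / 2 \<le> norm (f (ladder 4) - f (ladder 2)) + norm (f (ladder 2) - f (ladder 0))"
      using norm_triangle_ineq[of "f (ladder 4) - f (ladder 2)" "f (ladder 2) - f (ladder 0)"] long by simp
    ultimately show "norm (f (ladder 2) - f (ladder 0)) = norm (ladder 2 - ladder 0)"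
      using norm_ladder_diff[of 0 2] by simp
  qed
  then show ?thesis using norm_ladder_diff[of 0 2] by simp
qed

text \<open>
  If two consecutive steps of length \<open>r\<close> together cover \<open>2 * r\<close>, they are equal as vectors by the
  parallelogram law.
\<close>

lemma equal_steps:
  fixes g :: "nat \<Rightarrow> 'a::real_inner"
  assumes one: "\<And>i. i < k \<Longrightarrow> norm (g (Suc i) - g i) = r"
    and two: "\<And>i. Suc i < k \<Longrightarrow> norm (g (Suc (Suc i)) - g i) = 2 * r"
    and "i \<le> k"
  shows "g i - g 0 = real i *\<^sub>R (g 1 - g 0)"
proof -
  have const: "g (Suc i) - g i = g 1 - g 0" if "i < k" for i
    using that
  proof (induction i)
    case 0
    then show ?case by simp
  next
    case (Suc i)
    define u v where "u = g (Suc i) - g i" and "v = g (Suc (Suc i)) - g (Suc i)"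
    have "norm u = r" "norm v = r" using one[of i] one[of "Suc i"] Suc.prems by (simp_all add: u_def v_def)
    moreover have "norm (u + v) = 2 * r" using two[of i] Suc.prems by (simp add: u_def v_def)
    moreover have "(norm (u - v))\<^sup>2 = 2 * (norm u)\<^sup>2 + 2 * (norm v)\<^sup>2 - (norm (u + v))\<^sup>2"
      by (simp add: power2_norm_eq_inner inner_add_left inner_add_right inner_diff_left inner_diff_right)
    ultimately have "(norm (u - v))\<^sup>2 = 0" by (simp add: power2_eq_square)
    then have "v = u" by simp
    then show ?case using Suc by (simp add: u_def v_def)
  qed
  have "g i - g 0 = (\<Sum>j<i. g (Suc j) - g j)" by (simp add: sum_lessThan_telescope)
  also have "\<dots> = (\<Sum>j<i. g 1 - g 0)" using \<open>i \<le> k\<close> by (intro sum.cong refl const) simp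
  finally show ?thesis by (simp add: sum_constant_scaleR)
qed

lemma multiples_rigid: "3 / 8 * real k \<in> rigid_distances"
proof -
  let ?T = "ladder ` {..k}"
  have "norm (ladder k - ladder 0) \<in> rigid_distances"
  proof (rule rigid_distanceI[of ?T])
    show "finite ?T" "?T \<subseteq> rational_points" "ladder k \<in> ?T" "ladder 0 \<in> ?T"
      using ladder_rational by auto
    fix f :: "real ^ 8 \<Rightarrow> real ^ 8"
    assume f: "\<And>a b. a \<in> ?T \<Longrightarrow> b \<in> ?T \<Longrightarrow> norm (a - b) \<in> rigid_distances \<Longrightarrow>
      norm (f a - f b) = norm (a - b)"
    have step: "norm (f (ladder (Suc i)) - f (ladder i)) = 3 / 8" if "i < k" for i
      using f[of "ladder (Suc i)" "ladder i"] that norm_ladder_diff[of i "Suc i"] three_eighths_rigid by simp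
    have "norm (f (ladder (Suc (Suc i))) - f (ladder i)) = 2 * (3 / 8)" if "Suc i < k" for i
      using f[of "ladder (Suc (Suc i))" "ladder i"] that
        norm_ladder_diff[of i "Suc (Suc i)"] three_quarters_rigid by simp
    then have equal: "f (ladder k) - f (ladder 0) = real k *\<^sub>R (f (ladder 1) - f (ladder 0))"
      using equal_steps[of k "f \<circ> ladder" "3 / 8" k] step by simp
    show "norm (f (ladder k) - f (ladder 0)) = norm (ladder k - ladder 0)"
    proof (cases "k = 0")
      case False
      then have "norm (f (ladder k) - f (ladder 0)) = real k * (3 / 8)"
        using step[of 0] equal by simp
      then show ?thesis using norm_ladder_diff[of 0 k] by simp
    qed simp
  qed
  then show ?thesis using norm_ladder_diff[of 0 k] by simp
qed

section \<open>Arbitrary rational pairs\<close>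

lemma collinear_from_norms:
  fixes u v :: "'a::real_inner"
  assumes "norm u = r" "norm v = k * r" "norm (v - u) = (k - 1) * r"
  shows "v = k *\<^sub>R u"
proof -
  have "(norm (v - u))\<^sup>2 = (norm v)\<^sup>2 - 2 * (u \<bullet> v) + (norm u)\<^sup>2"
    by (simp add: power2_norm_eq_inner inner_diff_left inner_diff_right inner_commute)
  then have uv: "u \<bullet> v = k * r\<^sup>2" using assms by (simp add: power2_eq_square algebra_simps)
  have "(norm (v - k *\<^sub>R u))\<^sup>2 = (norm v)\<^sup>2 - 2 * k * (u \<bullet> v) + k\<^sup>2 * (norm u)\<^sup>2"
    unfolding power2_norm_eq_inner
    by (simp add: inner_diff_left inner_diff_right inner_commute power2_eq_square algebra_simps)
  also have "\<dots> = 0" using assms uv by (simp add: power2_eq_square algebra_simps)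
  finally show ?thesis by simp
qed

text \<open>
  Place \<open>c\<close> and \<open>d\<close> at the base of an isosceles triangle with apex \<open>p\<close> and prolong its legs
  \<open>k\<close>-fold from \<open>p\<close> to \<open>a\<close> and \<open>b\<close>. If the leg length \<open>r\<close> is a multiple of \<open>3 / 8\<close>, all
  distances along the legs are rigid, so the images of the legs are divided in the same ratio and
  the rigid length of \<open>a - b\<close> determines that of \<open>c - d\<close>.
\<close>

lemma division_rigid:
  fixes c d :: "real ^ 8"
  assumes rat: "c \<in> rational_points" "d \<in> rational_points" and "k > 0"
    and multiple: "real k * norm (c - d) \<in> rigid_distances"
  shows "norm (c - d) \<in> rigid_distances"
proof -
  obtain N :: nat where N: "norm (c - d) < real N" using reals_Archimedean2 by blast
  \<comment> \<open>Long enough for the two legs to meet: \<open>3 / 4 * N\<close> exceeds half the base.\<close>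
  define r where "r = 3 / 8 * real (2 * N)"
  have "norm (c - d) / 2 \<le> r" using N by (simp add: r_def)
  then have "(norm (c - d) / 2)\<^sup>2 \<le> r\<^sup>2" by (intro power_mono) auto
  moreover have "(norm (c - d) / 2)\<^sup>2 \<in> \<rat>"
    using norm_power2_rational[OF rational_points_diff[OF rat]] by (simp add: power_divide)
  ultimately obtain w where w: "w \<in> rational_points" "w \<bullet> (c - d) = 0"
      "(norm w)\<^sup>2 = r\<^sup>2 - (norm (c - d) / 2)\<^sup>2"
    using rational_perpendicular_exists[of "c - d" "r\<^sup>2 - (norm (c - d) / 2)\<^sup>2"]
      rational_points_diff[OF rat] by (auto simp: r_def)
  define e where "e = (1 / 2) *\<^sub>R (c - d)"
  define p where "p = c - e + w"
  define a where "a = p + real k *\<^sub>R (c - p)"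
  define b where "b = p + real k *\<^sub>R (d - p)"
  have r0: "r \<ge> 0" by (simp add: r_def)
  have e: "norm e = norm (c - d) / 2" "w \<bullet> e = 0" using w(2) by (simp_all add: e_def)
  have "(norm (e - w))\<^sup>2 = (norm e)\<^sup>2 + (norm w)\<^sup>2" "(norm (- e - w))\<^sup>2 = (norm e)\<^sup>2 + (norm w)\<^sup>2"
    unfolding power2_norm_eq_inner using e(2)
    by (simp_all add: inner_diff_left inner_diff_right inner_commute)
  then have "(norm (e - w))\<^sup>2 = r\<^sup>2" "(norm (- e - w))\<^sup>2 = r\<^sup>2"
    using w(3) e(1) by simp_all
  moreover have "c - p = e - w" by (simp add: p_def)
  moreover have "d - p = - e - w"
  proof -
    have "c - d = 2 *\<^sub>R e" by (simp add: e_def)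
    then show ?thesis by (simp add: p_def algebra_simps scaleR_2)
  qed
  ultimately have legs: "norm (c - p) = r" "norm (d - p) = r"
    using r0 by (auto intro: power2_eq_imp_eq)
  have rat_p: "p \<in> rational_points"
    unfolding p_def e_def using rat w(1) by (intro rational_points_intros) auto
  let ?T = "{p, a, b, c, d}"
  show ?thesis
  proof (rule rigid_distanceI[of ?T])
    show "finite ?T" "?T \<subseteq> rational_points" "c \<in> ?T" "d \<in> ?T"
      using rat rat_p by (auto simp: a_def b_def intro!: rational_points_intros)
    fix f :: "real ^ 8 \<Rightarrow> real ^ 8"
    assume f: "\<And>a b. a \<in> ?T \<Longrightarrow> b \<in> ?T \<Longrightarrow> norm (a - b) \<in> rigid_distances \<Longrightarrow>
      norm (f a - f b) = norm (a - b)"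
    have multiple_r: "real m * r \<in> rigid_distances" for m
      using multiples_rigid[of "m * (2 * N)"] by (simp add: r_def mult_ac)
    have side: "f z - f p = real k *\<^sub>R (f y - f p)"
      if "y \<in> ?T" "z \<in> ?T" "norm (y - p) = r" "z = p + real k *\<^sub>R (y - p)" for y z
    proof (rule collinear_from_norms)
      have "z - p = real k *\<^sub>R (y - p)" "z - y = real (k - 1) *\<^sub>R (y - p)"
        using \<open>k > 0\<close> that(4) by (simp_all add: of_nat_diff algebra_simps)
      then have "norm (z - p) = real k * r" "norm (z - y) = real (k - 1) * r"
        using that(3) by simp_all
      then show "norm (f y - f p) = r" "norm (f z - f p) = real k * r"
          "norm ((f z - f p) - (f y - f p)) = (real k - 1) * r"
        using f[OF that(1), of p] f[OF that(2), of p] f[OF that(2,1)] that(3)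
          multiple_r[of 1] multiple_r[of k] multiple_r[of "k - 1"] \<open>k > 0\<close>
        by (simp_all add: of_nat_diff)
    qed
    have ab: "a - b = real k *\<^sub>R (c - d)" by (simp add: a_def b_def algebra_simps)
    have "f a - f p = real k *\<^sub>R (f c - f p)" "f b - f p = real k *\<^sub>R (f d - f p)"
      using side[of c a] side[of d b] legs by (simp_all add: a_def b_def)
    then have "(f a - f p) - (f b - f p) = real k *\<^sub>R (f c - f p) - real k *\<^sub>R (f d - f p)"
      by simp
    then have "f a - f b = real k *\<^sub>R (f c - f d)"
      unfolding scaleR_right_diff_distrib[symmetric] by simp
    moreover have "norm (f a - f b) = real k * norm (c - d)"
      using f[of a b] ab multiple by simp
    ultimately show "norm (f c - f d) = norm (c - d)" using \<open>k > 0\<close> by simp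
  qed
qed

lemma norm_median:
  fixes p a b m :: "'a::real_inner"
  assumes "norm (m - a) = s" "norm (b - m) = s" "norm (a - b) = 2 * s"
    and "norm (p - a) = t" "norm (p - b) = t"
  shows "(norm (p - m))\<^sup>2 = t\<^sup>2 - s\<^sup>2"
proof -
  have "b - a = 2 *\<^sub>R (m - a)"
    using assms by (intro collinear_from_norms[of _ s]) (simp_all add: norm_minus_commute)
  then have ab: "a = m - (m - a)" "b = m + (m - a)" by (simp_all add: algebra_simps scaleR_2)
  define u where "u = m - a"
  have "(norm (p - m + u))\<^sup>2 = t\<^sup>2" "(norm (p - m - u))\<^sup>2 = t\<^sup>2" "(norm u)\<^sup>2 = s\<^sup>2"
    using assms ab by (simp_all add: u_def algebra_simps)
  moreover have "(norm (p - m + u))\<^sup>2 + (norm (p - m - u))\<^sup>2 = 2 * (norm (p - m))\<^sup>2 + 2 * (norm u)\<^sup>2"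
    unfolding power2_norm_eq_inner
    by (simp add: inner_add_left inner_add_right inner_diff_left[of "p - m"]
        inner_diff_right[of _ "p - m"] inner_commute)
  ultimately show ?thesis by simp
qed

text \<open>
  The altitude of an isosceles triangle with rigid base and legs, and base midpoint \<open>x\<close>: with
  \<open>s = (3 / 8) (n - 1)\<close> and \<open>t = (3 / 8) (n + 1)\<close> one has \<open>t\<^sup>2 - s\<^sup>2 = (9 / 16) n\<close>.
  The triangle exists for \<open>n \<ge> 1\<close>, degenerating to a segment at \<open>n = 1\<close>.
\<close>

lemma square_roots_rigid: "3 / 4 * sqrt (real n) \<in> rigid_distances"
proof (cases "n = 0")
  case True
  then show ?thesis using multiples_rigid[of 0] by simp
next
  case False
  have "norm (y - x) \<in> rigid_distances"
    if rat: "x \<in> rational_points" "y \<in> rational_points" and d: "norm (y - x) = 3 / 4 * sqrt (real n)"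
    for y x :: "real ^ 8"
  proof -
    define s where "s = 3 / 8 * real (n - 1)"
    define t where "t = 3 / 8 * real (n + 1)"
    have st: "s \<ge> 0" "t \<ge> 0" "t\<^sup>2 = (norm (y - x))\<^sup>2 + s\<^sup>2"
      using False by (simp_all add: s_def t_def d power2_eq_square of_nat_diff field_simps)
    obtain w where w: "w \<in> rational_points" "w \<bullet> (y - x) = 0" "(norm w)\<^sup>2 = s\<^sup>2"
      using rational_perpendicular_exists[of "y - x" "s\<^sup>2"] rational_points_diff[OF rat(2,1)]
      by (auto simp: s_def)
    have norm_w: "norm w = s" using w(3) st(1) by (auto intro: power2_eq_imp_eq)
    define a b where "a = x + w" and "b = x - w"
    have "(norm (y - a))\<^sup>2 = t\<^sup>2" "(norm (y - b))\<^sup>2 = t\<^sup>2"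
    proof -
      have eqs: "y - a = (y - x) - w" "y - b = (y - x) + w" by (simp_all add: a_def b_def)
      show "(norm (y - a))\<^sup>2 = t\<^sup>2" "(norm (y - b))\<^sup>2 = t\<^sup>2"
        using w(2,3) unfolding st(3) eqs power2_norm_eq_inner
        by (simp_all add: inner_add_left inner_add_right inner_commute
            inner_diff_left[of "y - x"] inner_diff_right[of _ "y - x"])
    qed
    then have legs: "norm (y - a) = t" "norm (y - b) = t"
      using st(2) by (auto intro: power2_eq_imp_eq)
    have ab: "norm (a - b) = 2 * s" "norm (x - a) = s" "norm (b - x) = s"
      using norm_w by (simp_all add: a_def b_def flip: scaleR_2)
    have in_D: "s \<in> rigid_distances" "t \<in> rigid_distances" "2 * s \<in> rigid_distances"
      using multiples_rigid[of "n - 1"] multiples_rigid[of "n + 1"] multiples_rigid[of "2 * (n - 1)"]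
      by (simp_all add: s_def t_def)
    let ?T = "{x, y, a, b}"
    show ?thesis
    proof (rule rigid_distanceI[of ?T])
      show "finite ?T" "?T \<subseteq> rational_points" "y \<in> ?T" "x \<in> ?T"
        using rat w(1) by (auto simp: a_def b_def intro!: rational_points_intros)
      fix f :: "real ^ 8 \<Rightarrow> real ^ 8"
      assume f: "\<And>a b. a \<in> ?T \<Longrightarrow> b \<in> ?T \<Longrightarrow> norm (a - b) \<in> rigid_distances \<Longrightarrow>
        norm (f a - f b) = norm (a - b)"
      have "(norm (f y - f x))\<^sup>2 = t\<^sup>2 - s\<^sup>2"
        using f[of a b] f[of x a] f[of b x] f[of y a] f[of y b] ab legs in_D
        by (intro norm_median[of _ "f a" _ "f b"]) simp_all
      then show "norm (f y - f x) = norm (y - x)"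
        using st(3) by (auto intro: power2_eq_imp_eq)
    qed
  qed
  then have "rigid_pair y x"
    if "x \<in> rational_points" "y \<in> rational_points" "norm (y - x) = 3 / 4 * sqrt (real n)" for y x
    using that unfolding rigid_distances_def by blast
  then show ?thesis unfolding rigid_distances_def by blast
qed

lemma rational_pairs_rigid:
  fixes x y :: "real ^ 8"
  assumes "x \<in> rational_points" "y \<in> rational_points"
  shows "norm (x - y) \<in> rigid_distances"
proof -
  have "(norm (x - y))\<^sup>2 \<in> \<rat>" using assms by (intro norm_power2_rational rational_points_diff)
  then obtain s t :: nat where st: "t \<noteq> 0" "\<bar>(norm (x - y))\<^sup>2\<bar> = real s / real t"
    using Rats_abs_nat_div_natE by metis
  \<comment> \<open>The factor \<open>3 * t\<close> clears the denominator of the squared distance and makes the square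
    \<open>9 * s * t\<close> of the left side \<open>9 / 16\<close> times an integer.\<close>
  have "real (3 * t) * norm (x - y) = 3 / 4 * sqrt (real (16 * s * t))"
  proof (rule power2_eq_imp_eq)
    show "(real (3 * t) * norm (x - y))\<^sup>2 = (3 / 4 * sqrt (real (16 * s * t)))\<^sup>2"
      using st by (simp add: power_mult_distrib power2_eq_square field_simps)
  qed auto
  then have "real (3 * t) * norm (x - y) \<in> rigid_distances"
    by (simp only: square_roots_rigid)
  then show ?thesis using division_rigid[OF assms, of "3 * t"] st(1) by simp
qed

theorem theorem2:
  fixes x y :: "real ^ 8"
  assumes "x \<in> rational_points" and "y \<in> rational_points"
  shows "\<exists>S. finite S \<and> S \<subseteq> rational_points \<and> x \<in> S \<and> y \<in> S \<and>
    (\<forall>f :: real ^ 8 \<Rightarrow> real ^ 8. preserves_unit_distance_on S f \<longrightarrow>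
        norm (f x - f y) = norm (x - y))"
proof -
  have "rigid_pair x y"
    using rational_pairs_rigid[OF assms] assms unfolding rigid_distances_def by blast
  then show ?thesis unfolding rigid_pair_def .
qed

end
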